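(* Suppose that the continuum hypothesis is true, or even just that $\mathfrak{b}=\mathfrak{d}$. Then there exists a set $X\subseteq 2^\omega$ which is a $(\dagger)$-$\lambda'$-set but not a $\lambda'$-set.
   Context: A set $X\subseteq 2^\omega$ is a $\lambda'$-set iff for every countable $A\subseteq 2^\omega$ there exists a $G_\delta$ set $G\subseteq 2^\omega$ such that $(X\cup A)\cap G=A$. Identify subsets of $\omega$ with their characteristic functions, so that $[\omega]^\omega$ (the set of infinite subsets of $\omega$) is a subset of $2^\omega$. For $a\in[\omega]^\omega$ write $a=\{a_0<a_1<a_2<\cdots\}$ for its increasing enumeration. For $f\in\omega^\omega$ let $$G_f=\{a\in[\omega]^\omega : \forall n\ \exists m>n\ \ a_m<f(m)\}.$$ A set $X\subseteq 2^\omega$ is a $(\dagger)$-$\lambda'$-set iff for every $f\in\omega^\omega$ the set $X\cap G_f$ is a $\lambda'$-set. For $f,g\in\omega^\omega$, $f\leq^* g$ means $f(n)\leq g(n)$ for all but finitely many $n$. $\mathfrak{b}$ is the least cardinality of a $\leq^*$-unbounded subset of $\omega^\omega$ and $\mathfrak{d}$ is the least cardinality of a $\leq^*$-dominating subset of $\omega^\omega$. *)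

theory Defs
  imports "HOL-Analysis.Analysis" "HOL-Library.Infinite_Set"
begin

unbundle cardinal_syntax

(* The Cantor space is the type nat => bool; its topology is the library's product topology
   on functions, with the discrete topology on bool. *)
type_synonym cantor = "nat \<Rightarrow> bool"

definition lambda_prime_set :: "cantor set \<Rightarrow> bool" where
  "lambda_prime_set X \<longleftrightarrow> (\<forall>A. countable A \<longrightarrow> (\<exists>G. gdelta G \<and> (X \<union> A) \<inter> G = A))"

(* A point a of the Cantor space is the characteristic function of the set {k. a k}.  The
   infinitude conjunct is needed: enumerate S m is the m-th element of S, counting from 0,
   only for infinite S. *)
definition G_set :: "(nat \<Rightarrow> nat) \<Rightarrow> cantor set" where
  "G_set f = {a. infinite {k. a k} \<and> (\<forall>n. \<exists>m>n. enumerate {k. a k} m < f m)}"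

definition dagger_lambda_prime_set :: "cantor set \<Rightarrow> bool" where
  "dagger_lambda_prime_set X \<longleftrightarrow> (\<forall>f. lambda_prime_set (X \<inter> G_set f))"

definition le_star :: "(nat \<Rightarrow> nat) \<Rightarrow> (nat \<Rightarrow> nat) \<Rightarrow> bool" (infix "\<le>*" 50) where
  "f \<le>* g \<longleftrightarrow> (\<forall>\<^sub>\<infinity>n. f n \<le> g n)"

definition star_unbounded :: "(nat \<Rightarrow> nat) set \<Rightarrow> bool" where
  "star_unbounded B \<longleftrightarrow> \<not> (\<exists>g. \<forall>f\<in>B. f \<le>* g)"

definition star_dominating :: "(nat \<Rightarrow> nat) set \<Rightarrow> bool" where
  "star_dominating D \<longleftrightarrow> (\<forall>g. \<exists>f\<in>D. g \<le>* f)"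

(* Cardinals are represented by cardinal orders, unique only up to order isomorphism (=o).
   The lemma least_card below shows that the choice is well defined in this sense. *)
definition least_card :: "('a set \<Rightarrow> bool) \<Rightarrow> 'a rel" where
  "least_card P = (SOME r. (\<exists>A. P A \<and> r = |A| ) \<and> (\<forall>B. P B \<longrightarrow> r \<le>o |B| ))"

lemma least_card:
  assumes "P A0"
  shows "\<exists>A. P A \<and> least_card P = |A|" and "\<And>B. P B \<Longrightarrow> least_card P \<le>o |B|"
proof -
  have "\<exists>r \<in> card_of ` Collect P. \<forall>r' \<in> card_of ` Collect P. r \<le>o r'"
    using assms by (intro exists_minim_Card_order) (auto simp: card_of_Card_order)
  then have "\<exists>r. (\<exists>A. P A \<and> r = |A| ) \<and> (\<forall>B. P B \<longrightarrow> r \<le>o |B| )"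
    by auto
  from someI_ex[OF this, folded least_card_def]
  show "\<exists>A. P A \<and> least_card P = |A|" and "\<And>B. P B \<Longrightarrow> least_card P \<le>o |B|"
    by auto
qed

lemma star_dominating_UNIV: "star_dominating UNIV"
proof -
  have "g \<le>* g" for g
    by (simp add: le_star_def)
  then show ?thesis
    unfolding star_dominating_def by blast
qed

lemma star_unbounded_UNIV: "star_unbounded UNIV"
proof -
  have "\<not> Suc \<circ> g \<le>* g" for g
    by (simp add: le_star_def Alm_all_def)
  then show ?thesis
    unfolding star_unbounded_def by blast
qed

definition bounding_number :: "(nat \<Rightarrow> nat) rel"  ("\<bb>") where
  "\<bb> = least_card star_unbounded"

definition dominating_number :: "(nat \<Rightarrow> nat) rel"  ("\<dd>") where
  "\<dd> = least_card star_dominating"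

(* The cardinality of the continuum is the cardinal successor of aleph_0. *)
definition continuum_hypothesis :: bool where
  "continuum_hypothesis \<longleftrightarrow> |UNIV :: (nat \<Rightarrow> bool) set| =o cardSuc natLeq"

end

theory Submission
  imports Defs
begin

text \<open>
  The set \<open>X\<close> consists of the ranges of a dominating family of strictly increasing functions with
  the extra property that every \<open>f\<close> is eventually bounded by all but fewer than \<open>\<bb>\<close> members.
  Such a family exists as soon as \<open>\<dd> \<le> \<bb>\<close>: well-order a dominating family \<open>D\<close> of size
  \<open>\<dd>\<close> in type \<open>\<dd>\<close>; every proper initial segment has fewer than \<open>\<bb>\<close> elements, hence a
  common bound, and each \<open>\<delta>\<close> in \<open>D\<close> is replaced by a strictly increasing function eventually
  above \<open>\<delta>\<close> and each of its predecessors (\<open>dominating_family_cofinal\<close>). Once \<open>f\<close> is bounded by some member of \<open>D\<close>, it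
  is bounded by all replacements from there on. Both alternatives of the hypothesis
  give \<open>\<dd> \<le> \<bb>\<close>; under the continuum hypothesis this is because \<open>\<bb>\<close> is uncountable.

  The range of a strictly increasing \<open>h\<close> with \<open>f \<le>* h\<close> is not in \<open>G_set f\<close>, so \<open>X \<inter> G_set f\<close>
  has fewer than \<open>\<bb>\<close> elements, and any set that small is a \<open>\<lambda>'\<close>-set
  (\<open>lambda_prime_set_if_less_bounding_number\<close>): for countable \<open>A\<close>, the functions
  measuring how long a point of the small set outside \<open>A\<close> agrees with those of \<open>A\<close> have a common bound, and
  that bound says how small the neighbourhoods of the points of \<open>A\<close> must be taken.

  On the other hand, \<open>X\<close> itself is not a \<open>\<lambda>'\<close>-set, as is seen by taking for \<open>A\<close> the finite subsets
  of \<open>\<omega>\<close>. For every \<open>k\<close>, an open set around \<open>A\<close> contains every point with a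
  sufficiently long gap starting at \<open>k\<close> (\<open>open_superset_finite_contains_gap\<close>). Hence a \<open>G\<^sub>\<delta>\<close> set
  around \<open>A\<close> contains every infinite set whose enumeration grows fast enough
  (\<open>gdelta_superset_finite_contains_fast\<close>), and \<open>X\<close> has such an element because its family is
  dominating.
\<close>

section \<open>Eventual domination and small cardinals\<close>

lemma le_star_trans: "f \<le>* g \<Longrightarrow> g \<le>* h \<Longrightarrow> f \<le>* h"
  unfolding le_star_def MOST_nat by (meson le_trans max_less_iff_conj)

lemma le_star_if_le: "(\<And>n. f n \<le> g n) \<Longrightarrow> f \<le>* g"
  by (simp add: le_star_def)

lemma bounded_if_less_bounding_number:
  fixes \<phi> :: "'a \<Rightarrow> nat \<Rightarrow> nat"
  assumes "|Y| <o \<bb>"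
  shows "\<exists>g. \<forall>y\<in>Y. \<phi> y \<le>* g"
proof (rule ccontr)
  assume "\<not> ?thesis"
  then have "star_unbounded (\<phi> ` Y)"
    by (simp add: star_unbounded_def)
  then have "\<bb> \<le>o |\<phi> ` Y|"
    unfolding bounding_number_def by (rule least_card(2)[of star_unbounded, OF star_unbounded_UNIV])
  also have "|\<phi> ` Y| \<le>o |Y|" by (rule card_of_image)
  finally show False using assms not_ordLess_ordLeq by blast
qed

text \<open>
  A diagonal argument: at \<open>n\<close> only the first functions of an enumeration, up to index \<open>n\<close>,
  need to be bounded.
\<close>
lemma bounded_if_countable:
  assumes "countable B"
  shows "\<exists>g. \<forall>f\<in>B. f \<le>* g"
proof (cases "B = {}")
  case False
  define g where "g n = (\<Sum>i\<le>n. from_nat_into B i n)" for n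
  have "f \<le>* g" if "f \<in> B" for f
  proof -
    obtain i where i: "from_nat_into B i = f"
      using from_nat_into_surj[OF assms \<open>f \<in> B\<close>] by blast
    have "f n \<le> g n" if "n > i" for n
      unfolding g_def i[symmetric] using that
      by (intro member_le_sum[where f = "\<lambda>i. from_nat_into B i n"]) auto
    then show ?thesis unfolding le_star_def MOST_nat by blast
  qed
  then show ?thesis by blast
qed auto

text \<open>A function is determined by its graph, coded as a set of natural numbers.\<close>
lemma card_nat_functions: "|UNIV :: (nat \<Rightarrow> nat) set| \<le>o |UNIV :: (nat \<Rightarrow> bool) set|"
proof -
  have "inj (\<lambda>(f :: nat \<Rightarrow> nat) k. f (fst (prod_decode k)) = snd (prod_decode k))"
  proof (rule injI, rule ext)
    fix f g :: "nat \<Rightarrow> nat" and n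
    assume "(\<lambda>k. f (fst (prod_decode k)) = snd (prod_decode k))
          = (\<lambda>k. g (fst (prod_decode k)) = snd (prod_decode k))"
    from fun_cong[OF this, of "prod_encode (n, f n)"] show "f n = g n" by simp
  qed
  then show ?thesis using card_of_ordLeq by blast
qed

lemma dominating_le_bounding_number:
  assumes "continuum_hypothesis \<or> \<bb> =o \<dd>"
  shows "\<dd> \<le>o \<bb>"
  using assms
proof
  assume "\<bb> =o \<dd>"
  then show ?thesis using ordIso_symmetric ordIso_imp_ordLeq by blast
next
  assume ch: "continuum_hypothesis"
  obtain B where B: "star_unbounded B" "\<bb> = |B|"
    using least_card(1)[of star_unbounded, OF star_unbounded_UNIV] unfolding bounding_number_def by blast
  have "\<not> countable B"
    using B(1) bounded_if_countable unfolding star_unbounded_def by blast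
  then have "\<not> |B| \<le>o |UNIV :: nat set|"
    by (simp add: countable_def flip: card_of_ordLeq)
  then have "\<not> |B| \<le>o natLeq"
    using card_of_nat ordIso_symmetric ordLeq_ordIso_trans by blast
  then have "natLeq <o |B|"
    using not_ordLeq_iff_ordLess[OF natLeq_Well_order card_of_Well_order] by blast
  then have "cardSuc natLeq \<le>o |B|"
    by (intro cardSuc_least) (simp_all add: natLeq_Card_order card_of_Card_order)
  moreover have "\<dd> \<le>o |UNIV :: (nat \<Rightarrow> nat) set|"
    unfolding dominating_number_def
    by (rule least_card(2)[of star_dominating, OF star_dominating_UNIV star_dominating_UNIV])
  ultimately show ?thesis
    using card_nat_functions ch unfolding B(2) continuum_hypothesis_def
    by (meson ordLeq_transitive ordLeq_ordIso_trans)
qed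

section \<open>Sets with fewer than \<open>\<bb>\<close> elements\<close>

definition cylinder :: "cantor \<Rightarrow> nat \<Rightarrow> cantor set" where
  "cylinder a n = {x. \<forall>i<n. x i = a i}"

lemma open_cylinder: "open (cylinder a n)"
proof -
  have "open {f :: cantor. \<forall>i\<in>{..<n}. f (id i) \<in> {a i}}"
    by (rule product_topology_basis') (auto intro: open_discrete)
  then show ?thesis by (simp add: cylinder_def Ball_def)
qed

lemma open_contains_cylinder:
  assumes "open U" "a \<in> U"
  shows "\<exists>n. cylinder a n \<subseteq> U"
proof -
  obtain X where X: "a \<in> (\<Pi>\<^sub>E i\<in>UNIV. X i)" "finite {i. X i \<noteq> (UNIV :: bool set)}"
      "(\<Pi>\<^sub>E i\<in>UNIV. X i) \<subseteq> U"
    using product_topology_open_contains_basis[OF assms(1)[unfolded open_fun_def] assms(2)]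
    by (elim exE conjE) (rule that, simp_all)
  obtain n where n: "\<forall>i\<in>{i. X i \<noteq> UNIV}. i < n"
    using X(2)[unfolded finite_nat_set_iff_bounded] by (elim exE)
  have "cylinder a n \<subseteq> (\<Pi>\<^sub>E i\<in>UNIV. X i)"
  proof
    fix x assume x: "x \<in> cylinder a n"
    have "x i \<in> X i" for i
      using x n X(1) by (cases "X i = UNIV") (auto simp: cylinder_def PiE_iff)
    then show "x \<in> (\<Pi>\<^sub>E i\<in>UNIV. X i)" by (simp add: PiE_iff)
  qed
  then show ?thesis using X(3) by blast
qed

text \<open>
  List \<open>A\<close> as \<open>a\<^sub>0, a\<^sub>1, \<dots>\<close> with every element repeated infinitely often. A point lies in the
  \<open>G\<^sub>\<delta>\<close> set \<open>\<Inter>m. \<Union>n\<ge>m. cylinder a\<^sub>n (g n)\<close> iff it is in infinitely many of these cylinders,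
  so \<open>A\<close> is contained in it for every choice of \<open>g\<close>. A point outside \<open>A\<close> is outside it once \<open>g\<close>
  eventually exceeds the length of its agreement with \<open>a\<^sub>n\<close>, and fewer than \<open>\<bb>\<close> such conditions
  can be met by one \<open>g\<close>.
\<close>
lemma lambda_prime_set_if_less_bounding_number:
  assumes "|Y| <o \<bb>"
  shows "lambda_prime_set Y"
  unfolding lambda_prime_set_def
proof (intro allI impI)
  fix A :: "cantor set"
  assume A: "countable A"
  show "\<exists>G. gdelta G \<and> (Y \<union> A) \<inter> G = A"
  proof (cases "A = {}")
    case True
    have "gdelta (\<Inter>(range (\<lambda>n::nat. {} :: cantor set)))"
      by (rule gdelta.intros) auto
    then show ?thesis using True by auto
  next
    case False
    define a where "a n = from_nat_into A (fst (prod_decode n))" for n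
    have a_in: "a n \<in> A" for n
      unfolding a_def using False by (rule from_nat_into)
    have a_often: "\<exists>n\<ge>m. a n = x" if "x \<in> A" for x m
    proof -
      obtain k where "from_nat_into A k = x"
        using from_nat_into_surj[OF A \<open>x \<in> A\<close>] by blast
      then have "a (prod_encode (k, m)) = x" by (simp add: a_def)
      then show ?thesis using le_prod_encode_2 by blast
    qed
    define \<phi> where "\<phi> x n = Suc (LEAST i. x i \<noteq> a n i)" for x n
    obtain g where g: "\<And>x. x \<in> Y \<Longrightarrow> \<phi> x \<le>* g"
      using bounded_if_less_bounding_number[OF assms] by blast
    define F where "F m = (\<Union>n\<in>{m..}. cylinder (a n) (g n))" for m
    have "gdelta (\<Inter>(range F))"
      by (rule gdelta.intros) (auto simp: F_def open_cylinder)
    moreover have "A \<subseteq> \<Inter>(range F)"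
    proof
      fix x assume "x \<in> A"
      then show "x \<in> \<Inter>(range F)"
        using a_often by (force simp: F_def cylinder_def)
    qed
    moreover have "x \<in> A" if "x \<in> Y" "x \<in> \<Inter>(range F)" for x
    proof (rule ccontr)
      assume x: "x \<notin> A"
      obtain m where m: "\<And>n. n > m \<Longrightarrow> \<phi> x n \<le> g n"
        using g[OF \<open>x \<in> Y\<close>] unfolding le_star_def MOST_nat by blast
      have "x \<in> F (Suc m)" using that(2) by blast
      then obtain n where n: "n > m" "x \<in> cylinder (a n) (g n)"
        unfolding F_def by (auto simp: Suc_le_eq)
      have "x \<noteq> a n" using x a_in by metis
      then have "\<exists>i. x i \<noteq> a n i" by blast
      then have "x (LEAST i. x i \<noteq> a n i) \<noteq> a n (LEAST i. x i \<noteq> a n i)"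
        by (rule LeastI_ex)
      then show False
        using n m[OF n(1)] by (auto simp: \<phi>_def cylinder_def)
    qed
    ultimately show ?thesis by blast
  qed
qed

section \<open>\<open>G\<^sub>\<delta>\<close> sets around the finite sets\<close>

text \<open>
  For each of the finitely many subsets of \<open>{..<k}\<close>, viewed as points of \<open>U\<close>, openness
  yields a cylinder inside \<open>U\<close>; \<open>l\<close> is the maximum of their lengths.
\<close>
lemma open_superset_finite_contains_gap:
  assumes "open U" "{a. finite {k. a k}} \<subseteq> U"
  shows "\<exists>l. \<forall>x::cantor. (\<forall>i. k \<le> i \<and> i < l \<longrightarrow> \<not> x i) \<longrightarrow> x \<in> U"
proof -
  have "\<exists>n. cylinder (\<lambda>i. i \<in> s) n \<subseteq> U" if "s \<in> Pow {..<k}" for s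
  proof (rule open_contains_cylinder[OF assms(1)])
    have "finite s" using that finite_subset by blast
    then show "(\<lambda>i. i \<in> s) \<in> U" using assms(2) by auto
  qed
  then obtain N where N: "\<And>s. s \<in> Pow {..<k} \<Longrightarrow> cylinder (\<lambda>i. i \<in> s) (N s) \<subseteq> U"
    by metis
  have "x \<in> U" if gap: "\<forall>i. k \<le> i \<and> i < Max (N ` Pow {..<k}) \<longrightarrow> \<not> x i" for x
  proof -
    define s where "s = {i. i < k \<and> x i}"
    have s: "s \<in> Pow {..<k}" by (auto simp: s_def)
    have "N s \<le> Max (N ` Pow {..<k})" using s by (intro Max_ge) auto
    then have "x \<in> cylinder (\<lambda>i. i \<in> s) (N s)"
      using gap unfolding cylinder_def s_def by (auto simp: not_less)
    then show ?thesis using N[OF s] by blast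
  qed
  then show ?thesis by blast
qed

text \<open>
  Each of the consecutive intervals \<open>[h j, h (j + 1))\<close> with \<open>j \<ge> j0\<close> contributes a further
  element of \<open>S\<close>, so at least \<open>m + 1\<close> elements lie below the end of the interval numbered \<open>j0 + m\<close>.
\<close>
lemma enumerate_less_if_meets_intervals:
  fixes S :: "nat set"
  assumes "\<And>j. j \<ge> j0 \<Longrightarrow> \<exists>i\<in>S. h j \<le> i \<and> i < h (Suc j)"
  shows "enumerate S m < h (Suc (j0 + m))"
proof (induction m)
  case 0
  obtain i where "i \<in> S" "i < h (Suc j0)"
    using assms[of j0] by auto
  then show ?case
    by (simp add: enumerate_0 le_less_trans[OF Least_le])
next
  case (Suc m)
  have inf: "infinite S"
  proof
    assume "finite S"
    have "h (j0 + j) \<ge> j" for j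
    proof (induction j)
      case (Suc j)
      then show ?case using assms[of "j0 + j"] by force
    qed simp
    moreover obtain b where "\<forall>i\<in>S. i < b"
      using \<open>finite S\<close> finite_nat_set_iff_bounded by blast
    ultimately show False using assms[of "j0 + b"] by (metis le_add1 le_trans not_less)
  qed
  obtain i where i: "i \<in> S" "h (Suc (j0 + m)) \<le> i" "i < h (Suc (Suc (j0 + m)))"
    using assms[of "Suc (j0 + m)"] by auto
  have "enumerate S (Suc m) \<le> i"
    unfolding enumerate_Suc''[OF inf] using i Suc.IH by (intro Least_le) auto
  then show ?case using i(3) by simp
qed

text \<open>
  The function \<open>h\<close> below is chosen so that a gap \<open>[h j, h (j + 1))\<close> puts a point into all
  the open sets \<open>U n\<close> with \<open>n \<le> h j\<close>. If \<open>x\<close> is outside the \<open>n\<close>-th one, all late intervals meet \<open>x\<close>, so its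
  enumeration stays below a shift of \<open>h\<close>. The shift depends on \<open>x\<close>; doubling the argument
  of \<open>h\<close> absorbs it.
\<close>
lemma gdelta_superset_finite_contains_fast:
  assumes "gdelta G" "{a. finite {k. a k}} \<subseteq> G"
  shows "\<exists>f. \<forall>x. f \<le>* enumerate {k. x k} \<longrightarrow> x \<in> G"
proof -
  obtain U :: "nat \<Rightarrow> cantor set" where U: "\<And>n. open (U n)" "G = \<Inter>(range U)"
    using assms(1) by (auto elim: gdelta.cases)
  have "\<exists>l. \<forall>x. (\<forall>i. k \<le> i \<and> i < l \<longrightarrow> \<not> x i) \<longrightarrow> x \<in> U n" for k n
    using U assms(2) by (intro open_superset_finite_contains_gap) auto
  then obtain L where L: "\<And>k n x. (\<forall>i. k \<le> i \<and> i < L k n \<longrightarrow> \<not> x i) \<Longrightarrow> x \<in> U n"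
    by metis
  define next_end where "next_end k = Suc k + (\<Sum>n\<le>k. L k n)" for k
  define h where "h j = (next_end ^^ j) 0" for j
  have h_Suc: "h (Suc j) = next_end (h j)" for j by (simp add: h_def)
  have "strict_mono h"
    by (rule strict_monoI_Suc) (simp add: h_Suc next_end_def)
  then have h_ge: "j \<le> h j" for j by (rule strict_mono_imp_increasing)
  have "x \<in> G" if fast: "(\<lambda>m. h (Suc (2 * m))) \<le>* enumerate {k. x k}" for x
  proof (rule ccontr)
    assume "x \<notin> G"
    then obtain n where n: "x \<notin> U n" using U(2) by blast
    have "\<exists>i\<in>{k. x k}. h j \<le> i \<and> i < h (Suc j)" if "j \<ge> n" for j
    proof -
      have "n \<le> h j" using that h_ge le_trans by blast
      then have "L (h j) n \<le> (\<Sum>n\<le>h j. L (h j) n)" by (intro member_le_sum) auto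
      then have "L (h j) n \<le> h (Suc j)" by (simp add: h_Suc next_end_def)
      then show ?thesis using L[of "h j" n x] n by (metis less_le_trans mem_Collect_eq)
    qed
    then have below: "enumerate {k. x k} m < h (Suc (n + m))" for m
      by (rule enumerate_less_if_meets_intervals)
    obtain m0 where m0: "\<And>m. m > m0 \<Longrightarrow> h (Suc (2 * m)) \<le> enumerate {k. x k} m"
      using fast unfolding le_star_def MOST_nat by blast
    define m where "m = Suc (max m0 n)"
    have "h (Suc (n + m)) \<le> h (Suc (2 * m))"
      using strict_mono_less_eq[OF \<open>strict_mono h\<close>] by (simp add: m_def)
    moreover have "h (Suc (2 * m)) \<le> enumerate {k. x k} m"
      by (rule m0) (simp add: m_def)
    ultimately show False using below[of m] by linarith
  qed
  then show ?thesis by blast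
qed

section \<open>Dominating families of increasing functions\<close>

lemma enumerate_range_strict_mono:
  fixes f :: "nat \<Rightarrow> nat"
  assumes "strict_mono f"
  shows "infinite (range f)" "enumerate (range f) = f"
proof -
  show inf: "infinite (range f)"
    using assms range_inj_infinite strict_mono_imp_inj_on by blast
  show "enumerate (range f) = f"
  proof
    show "enumerate (range f) n = f n" for n
    proof (induction n)
      case 0
      show ?case unfolding enumerate_0
        using assms by (intro Least_equality) (auto simp: strict_mono_less_eq)
    next
      case (Suc n)
      show ?case unfolding enumerate_Suc''[OF inf] Suc.IH
        using assms by (intro Least_equality) (auto simp: strict_mono_less_eq strict_mono_less Suc_le_eq)
    qed
  qed
qed

lemma strict_mono_majorant:
  fixes f :: "nat \<Rightarrow> nat"
  shows "strict_mono (\<lambda>n. \<Sum>i\<le>n. Suc (f i))" "f n \<le> (\<Sum>i\<le>n. Suc (f i))"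
proof -
  show "strict_mono (\<lambda>n. \<Sum>i\<le>n. Suc (f i))" by (rule strict_monoI_Suc) simp
  have "Suc (f n) \<le> (\<Sum>i\<le>n. Suc (f i))" by (intro member_le_sum) auto
  then show "f n \<le> (\<Sum>i\<le>n. Suc (f i))" by simp
qed

text \<open>
  The least possible size of \<open>D\<close> makes its proper initial segments, in a well-order of minimal
  type, smaller than \<open>\<dd> \<le> \<bb>\<close>. This is used twice: an initial segment has an upper bound, from
  which \<open>s\<close> is built, and the indices \<open>\<delta>\<close> for which \<open>s \<delta>\<close> fails to dominate \<open>f\<close> lie in an
  initial segment.
\<close>
lemma dominating_family_cofinal:
  assumes "\<dd> \<le>o \<bb>"
  shows "\<exists>(D :: (nat \<Rightarrow> nat) set) s. (\<forall>\<delta>\<in>D. strict_mono (s \<delta>)) \<and> (\<forall>f. \<exists>\<delta>\<in>D. f \<le>* s \<delta>)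
    \<and> (\<forall>f. |{\<delta>\<in>D. \<not> f \<le>* s \<delta>}| <o \<bb>)"
proof -
  obtain D where D: "star_dominating D" "\<dd> = |D|"
    using least_card(1)[of star_dominating, OF star_dominating_UNIV] unfolding dominating_number_def by blast
  have small: "|underS |D| \<delta>| <o \<bb>" if "\<delta> \<in> D" for \<delta>
  proof -
    have "|underS |D| \<delta>| <o |D|"
      using that by (intro card_of_underS) (simp_all add: card_of_Card_order card_of_card_order_on Field_card_of)
    then show ?thesis using assms unfolding D(2) by (rule ordLess_ordLeq_trans)
  qed
  have "\<exists>h. strict_mono h \<and> \<delta> \<le>* h \<and> (\<forall>\<gamma>\<in>underS |D| \<delta>. \<gamma> \<le>* h)" if \<delta>: "\<delta> \<in> D" for \<delta>
  proof -
    obtain g where g: "\<forall>\<gamma>\<in>underS |D| \<delta>. \<gamma> \<le>* g"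
      using bounded_if_less_bounding_number[OF small[OF \<delta>], of "\<lambda>\<gamma>. \<gamma>"] by blast
    define h where "h n = (\<Sum>i\<le>n. Suc (max (g i) (\<delta> i)))" for n
    have max_le: "max (g n) (\<delta> n) \<le> h n" for n
      unfolding h_def by (rule strict_mono_majorant(2))
    have "g \<le>* h" "\<delta> \<le>* h"
      using max_le by (auto intro!: le_star_if_le)
    moreover have "strict_mono h"
      unfolding h_def by (rule strict_mono_majorant(1))
    ultimately show ?thesis using g le_star_trans by blast
  qed
  then obtain s where s: "\<And>\<delta>. \<delta> \<in> D \<Longrightarrow> strict_mono (s \<delta>)" "\<And>\<delta>. \<delta> \<in> D \<Longrightarrow> \<delta> \<le>* s \<delta>"
      "\<And>\<gamma> \<delta>. \<delta> \<in> D \<Longrightarrow> \<gamma> \<in> underS |D| \<delta> \<Longrightarrow> \<gamma> \<le>* s \<delta>"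
    by metis
  have "|{\<delta>\<in>D. \<not> f \<le>* s \<delta>}| <o \<bb>" for f
  proof -
    obtain \<delta>0 where \<delta>0: "\<delta>0 \<in> D" "f \<le>* \<delta>0"
      using D(1) unfolding star_dominating_def by blast
    have "{\<delta>\<in>D. \<not> f \<le>* s \<delta>} \<subseteq> underS |D| \<delta>0"
    proof safe
      fix \<delta> assume \<delta>: "\<delta> \<in> D" "\<not> f \<le>* s \<delta>"
      then have "\<not> \<delta>0 \<le>* s \<delta>" using \<delta>0(2) le_star_trans by blast
      then have "\<delta> \<noteq> \<delta>0" "\<delta>0 \<notin> underS |D| \<delta>" using s(2,3) \<delta>(1) by auto
      moreover have "(\<delta>, \<delta>0) \<in> |D| \<or> (\<delta>0, \<delta>) \<in> |D|"
        using card_of_well_order_on[of D] \<open>\<delta> \<noteq> \<delta>0\<close> \<delta>(1) \<delta>0(1)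
        unfolding well_order_on_def linear_order_on_def total_on_def by blast
      ultimately show "\<delta> \<in> underS |D| \<delta>0" unfolding underS_def by blast
    qed
    then show ?thesis
      using small[OF \<delta>0(1)] card_of_mono1 ordLeq_ordLess_trans by blast
  qed
  moreover have "\<exists>\<delta>\<in>D. f \<le>* s \<delta>" for f
    using D(1) s(2) le_star_trans unfolding star_dominating_def by blast
  ultimately show ?thesis using s(1) by blast
qed

section \<open>A \<open>(\<dagger>)\<close>-\<open>\<lambda>'\<close>-set that is not a \<open>\<lambda>'\<close>-set\<close>

theorem theorem2p1:
  assumes "continuum_hypothesis \<or> \<bb> =o \<dd>"
  shows "\<exists>X :: cantor set. dagger_lambda_prime_set X \<and> \<not> lambda_prime_set X"
proof -
  obtain D :: "(nat \<Rightarrow> nat) set" and s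
    where family: "(\<forall>\<delta>\<in>D. strict_mono (s \<delta>)) \<and> (\<forall>f. \<exists>\<delta>\<in>D. f \<le>* s \<delta>)
      \<and> (\<forall>f. |{\<delta>\<in>D. \<not> f \<le>* s \<delta>}| <o \<bb>)"
    using dominating_family_cofinal[OF dominating_le_bounding_number[OF assms]] by (elim exE)
  then have mono: "strict_mono (s \<delta>)" if "\<delta> \<in> D" for \<delta>
    using that by simp
  from family have dom: "\<exists>\<delta>\<in>D. f \<le>* s \<delta>" and small: "|{\<delta>\<in>D. \<not> f \<le>* s \<delta>}| <o \<bb>" for f
    by simp_all
  define p where "p \<delta> = (\<lambda>k. k \<in> range (s \<delta>))" for \<delta>
  have p_set: "{k. p \<delta> k} = range (s \<delta>)" for \<delta> by (auto simp: p_def)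
  note enum = enumerate_range_strict_mono[OF mono]
  have "lambda_prime_set (p ` D \<inter> G_set f)" for f
  proof (rule lambda_prime_set_if_less_bounding_number)
    have "p ` D \<inter> G_set f \<subseteq> p ` {\<delta>\<in>D. \<not> f \<le>* s \<delta>}"
    proof
      fix x assume x: "x \<in> p ` D \<inter> G_set f"
      then obtain \<delta> where \<delta>: "\<delta> \<in> D" "x = p \<delta>" by blast
      have "\<exists>m>n. s \<delta> m < f m" for n
        using x by (simp add: G_set_def \<delta>(2) p_set enum(2)[OF \<delta>(1)])
      then have "\<not> f \<le>* s \<delta>"
        unfolding le_star_def MOST_nat by (meson not_le)
      then show "x \<in> p ` {\<delta>\<in>D. \<not> f \<le>* s \<delta>}" using \<delta> by blast
    qed
    then have "|p ` D \<inter> G_set f| \<le>o |{\<delta>\<in>D. \<not> f \<le>* s \<delta>}|"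
      using ordLeq_transitive[OF card_of_mono1 card_of_image] by simp
    then show "|p ` D \<inter> G_set f| <o \<bb>" using small by (rule ordLeq_ordLess_trans)
  qed
  then have "dagger_lambda_prime_set (p ` D)"
    by (simp add: dagger_lambda_prime_set_def)
  moreover have "\<not> lambda_prime_set (p ` D)"
  proof
    assume lps: "lambda_prime_set (p ` D)"
    let ?Fin = "{a :: cantor. finite {k. a k}}"
    have "?Fin \<subseteq> (\<lambda>S k. k \<in> S) ` {S. finite S}"
    proof
      fix a :: cantor
      assume "a \<in> ?Fin"
      then show "a \<in> (\<lambda>S k. k \<in> S) ` {S. finite S}"
        by (intro image_eqI[where x = "{k. a k}"]) auto
    qed
    then have "countable ?Fin"
      by (rule countable_subset) (intro countable_image countable_Collect_finite)
    then obtain G where G: "gdelta G" "(p ` D \<union> ?Fin) \<inter> G = ?Fin"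
      using lps[unfolded lambda_prime_set_def, rule_format] by metis
    have "?Fin \<subseteq> G" using G(2) by blast
    then obtain f where f: "\<And>x. f \<le>* enumerate {k. x k} \<Longrightarrow> x \<in> G"
      using gdelta_superset_finite_contains_fast[OF G(1)] by metis
    obtain \<delta> where \<delta>: "\<delta> \<in> D" "f \<le>* s \<delta>" using dom by blast
    have "p \<delta> \<in> G" by (rule f) (simp add: p_set enum(2)[OF \<delta>(1)] \<delta>(2))
    then have "p \<delta> \<in> ?Fin" using G(2) \<delta>(1) by blast
    then show False using enum(1)[OF \<delta>(1)] by (simp add: p_set)
  qed
  ultimately show ?thesis by blast
qed

end
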